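(* There is a nontrivial (nonzero) element of $H_4(\mathrm{config}(8,3);\mathbb Z)$ that is simultaneously a (signed) sum of non-barrier generators, a (signed) sum of one-barrier generators, and a (signed) sum of two-barrier generators.
   Context: $\mathrm{config}(n,w)$ is the space of configurations of $n$ pairwise non-overlapping disks of diameter $1$, labeled $1,\dots,n$, in the strip $\mathbb R\times[0,w]$. It is homotopy equivalent to the cell complex $\mathrm{cel}(n,w)$ with one $(n-m)$-cell for each symbol $b_1\mid\cdots\mid b_m$, where the blocks are nonempty ordered lists of at most $w$ labels and each of $1,\dots,n$ occurs once; $\mathrm{cel}(n)=\mathrm{cel}(n,n)$. Boundary: for a one-block symbol $g$, $\partial g$ is the sum over all $a\mid b$ of which $g$ is a shuffle, with coefficient $(-1)^{\mathrm{length}(a)}$ times the sign of the permutation taking the list $g$ to $ab$; $\partial(g_1\mid g_2)=\partial g_1\mid g_2+(-1)^{\dim g_1}g_1\mid\partial g_2$. The concatenation product $\mid$ places symbols (on disjoint label sets) next to each other with a bar in between. Juxtaposition of linear combinations of one-block symbols concatenates lists inside a block, bilinearly. Wheel: for distinct labels $a_1,\dots,a_k$, $k\le w$: $W(a_1)=a_1$, $W(a_1,\dots,a_k)=W(a_1,\dots,a_{k-1})a_k+(-1)^ka_kW(a_1,\dots,a_{k-1})$, a $(k-1)$-cycle. Filter: for $r\ge3$ wheels $W_1,\dots,W_r$ (in any order) on disjoint label sets, with $k>w$ disks in total and each having at least $k-w$ disks, the $(k-2)$-cycle $\partial(W_1\cdots W_r)$ in $\mathrm{cel}(\cdot,w)$.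 The homology $H_*(\mathrm{config}(n,w))$ is spanned by concatenation products of wheels and filters with label sets partitioning $\{1,\dots,n\}$; these products are called generators. An element $z\in H_*(\mathrm{config}(m,w))$ is a barrier if the two ways of concatenating it with a one-disk $0$-cycle (on the left or on the right, with a new label) represent different homology classes. (Wheels of size $w$ and filters containing a wheel of size $1$ are barriers.) A generator is called non-barrier, one-barrier, or two-barrier if exactly zero, one, or two of its wheel and filter factors are barriers. *)

theory Defs
  imports
    "HOL-Homology.Homology"
    "HOL-Algebra.Generated_Groups"
    "HOL-Algebra.Free_Abelian_Groups"
    "HOL-Combinatorics.Permutations"
begin

section \<open>The configuration space\<close>

text \<open>
  The point \<open>p i\<close> is the centre of the disk with label \<open>i\<close>; disks have radius 1/2, and
  they may touch each other and the walls of the strip.  The product topology on \<open>{1..n}\<close>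
  consists of functions that are \<open>undefined\<close> outside \<open>{1..n}\<close>.

  config(n,w) is homotopy equivalent to cel(n,w), whose cellular homology is
  \<open>cel_homology {1..n} w\<close> below.  Wheels, filters and concatenation are cellular notions;
  they are transported to the singular homology of \<open>config n w\<close> by an isomorphism.
\<close>

definition config :: "nat \<Rightarrow> real \<Rightarrow> (nat \<Rightarrow> real \<times> real) topology" where
  "config n w = subtopology (product_topology (\<lambda>_. euclidean) {1..n})
     {p. (\<forall>i\<in>{1..n}. 1/2 \<le> snd (p i) \<and> snd (p i) \<le> w - 1/2) \<and>
         (\<forall>i\<in>{1..n}. \<forall>j\<in>{1..n}. i \<noteq> j \<longrightarrow> dist (p i) (p j) \<ge> 1)}"


section \<open>The cell complex and its homology\<close>

text \<open>
  The symbol $b_1 \mid \cdots \mid b_m$ is the list of lists \<open>[b\<^sub>1, \<dots>, b\<^sub>m]\<close>.  The factors of a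
  concatenation product live on arbitrary label sets, so \<open>L\<close> is any finite label set;
  cel(n,w) is the case \<open>L = {1..n}\<close>.
\<close>

type_synonym block = "nat list"
type_synonym symbol = "block list"

definition cells :: "nat set \<Rightarrow> nat \<Rightarrow> nat \<Rightarrow> symbol set" where
  "cells L w k = {s. (\<forall>b\<in>set s. b \<noteq> [] \<and> length b \<le> w) \<and>
     distinct (concat s) \<and> set (concat s) = L \<and> k + length s = card L}"

text \<open>The sign of the permutation taking the list \<open>g\<close> to its rearrangement \<open>h\<close>
  (for \<open>g\<close> without repetitions this permutation is unique).\<close>

definition rearrangement_sign :: "block \<Rightarrow> block \<Rightarrow> int" where
  "rearrangement_sign g h = sign (THE p. p permutes set g \<and> map p g = h)"

definition block_boundary :: "block \<Rightarrow> symbol \<Rightarrow>\<^sub>0 int" where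
  "block_boundary g = (\<Sum>(a, b) \<in> {(a, b). a \<noteq> [] \<and> b \<noteq> [] \<and> g \<in> shuffles a b}.
     frag_cmul ((-1) ^ length a * rearrangement_sign g (a @ b)) (frag_of [a, b]))"

text \<open>
  The bilinear extension of list append.  On chains of symbols it is the concatenation
  product $\mid$; on linear combinations of blocks it is juxtaposition.
\<close>

definition chain_append :: "('a list \<Rightarrow>\<^sub>0 int) \<Rightarrow> ('a list \<Rightarrow>\<^sub>0 int) \<Rightarrow> ('a list \<Rightarrow>\<^sub>0 int)" where
  "chain_append c d = frag_extend (\<lambda>s. frag_extend (\<lambda>t. frag_of (s @ t)) d) c"

text \<open>The Leibniz rule, with first factor the one-block symbol \<open>[g]\<close>, which has dimension
  \<open>length g - 1\<close>.\<close>

primrec symbol_boundary :: "symbol \<Rightarrow> symbol \<Rightarrow>\<^sub>0 int" where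
  "symbol_boundary [] = 0"
| "symbol_boundary (g # s) =
     chain_append (block_boundary g) (frag_of s)
     + frag_cmul ((-1) ^ (length g - 1)) (chain_append (frag_of [g]) (symbol_boundary s))"

definition boundary :: "(symbol \<Rightarrow>\<^sub>0 int) \<Rightarrow> (symbol \<Rightarrow>\<^sub>0 int)" where
  "boundary = frag_extend symbol_boundary"

definition cel_cycles :: "nat set \<Rightarrow> nat \<Rightarrow> nat \<Rightarrow> (symbol \<Rightarrow>\<^sub>0 int) set" where
  "cel_cycles L w k = {c \<in> carrier (free_Abelian_group (cells L w k)). boundary c = 0}"

definition cel_boundaries :: "nat set \<Rightarrow> nat \<Rightarrow> nat \<Rightarrow> (symbol \<Rightarrow>\<^sub>0 int) set" where
  "cel_boundaries L w k = boundary ` carrier (free_Abelian_group (cells L w (Suc k)))"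

definition cel_cycle_group :: "nat set \<Rightarrow> nat \<Rightarrow> nat \<Rightarrow> (symbol \<Rightarrow>\<^sub>0 int) monoid" where
  "cel_cycle_group L w k = subgroup_generated (free_Abelian_group (cells L w k)) (cel_cycles L w k)"

definition cel_homology :: "nat set \<Rightarrow> nat \<Rightarrow> nat \<Rightarrow> (symbol \<Rightarrow>\<^sub>0 int) set monoid" where
  "cel_homology L w k = cel_cycle_group L w k Mod cel_boundaries L w k"

definition cel_class :: "nat set \<Rightarrow> nat \<Rightarrow> nat \<Rightarrow> (symbol \<Rightarrow>\<^sub>0 int) \<Rightarrow> (symbol \<Rightarrow>\<^sub>0 int) set" where
  "cel_class L w k c = cel_boundaries L w k #>\<^bsub>cel_cycle_group L w k\<^esub> c"


section \<open>Wheels, filters and generators\<close>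

text \<open>The junk value at the empty list is irrelevant: wheels have at least one label.\<close>

fun wheel :: "nat list \<Rightarrow> block \<Rightarrow>\<^sub>0 int" where
  "wheel xs = (if length xs \<le> 1 then frag_of xs
     else chain_append (wheel (butlast xs)) (frag_of [last xs])
        + frag_cmul ((-1) ^ length xs) (chain_append (frag_of [last xs]) (wheel (butlast xs))))"

declare wheel.simps [simp del]

definition one_block :: "(block \<Rightarrow>\<^sub>0 int) \<Rightarrow> (symbol \<Rightarrow>\<^sub>0 int)" where
  "one_block = frag_extend (\<lambda>g. frag_of [g])"

datatype factor = Wheel "nat list" | Filter "nat list list"

fun factor_labels :: "factor \<Rightarrow> nat list" where
  "factor_labels (Wheel xs) = xs"
| "factor_labels (Filter ws) = concat ws"

fun valid_factor :: "nat \<Rightarrow> factor \<Rightarrow> bool" where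
  "valid_factor w (Wheel xs) \<longleftrightarrow> xs \<noteq> [] \<and> distinct xs \<and> length xs \<le> w"
| "valid_factor w (Filter ws) \<longleftrightarrow>
     3 \<le> length ws \<and> distinct (concat ws) \<and> w < length (concat ws) \<and>
     (\<forall>xs\<in>set ws. xs \<noteq> [] \<and> length xs \<le> w \<and> length (concat ws) - w \<le> length xs)"

fun factor_dim :: "factor \<Rightarrow> nat" where
  "factor_dim (Wheel xs) = length xs - 1"
| "factor_dim (Filter ws) = length (concat ws) - 2"

fun factor_chain :: "factor \<Rightarrow> symbol \<Rightarrow>\<^sub>0 int" where
  "factor_chain (Wheel xs) = one_block (wheel xs)"
| "factor_chain (Filter ws) =
     boundary (one_block (foldr chain_append (map wheel ws) (frag_of [])))"

text \<open>
  The elements of a homology class \<open>z\<close> are the cycles \<open>c\<close> representing it.  The choice of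
  \<open>c\<close> and of the new label \<open>x\<close> does not matter.
\<close>

definition barrier :: "nat set \<Rightarrow> nat \<Rightarrow> nat \<Rightarrow> (symbol \<Rightarrow>\<^sub>0 int) set \<Rightarrow> bool" where
  "barrier L w k z \<longleftrightarrow> z \<in> carrier (cel_homology L w k) \<and>
     (\<exists>c\<in>z. \<exists>x. x \<notin> L \<and>
        cel_class (insert x L) w k (chain_append (frag_of [[x]]) c) \<noteq>
        cel_class (insert x L) w k (chain_append c (frag_of [[x]])))"

definition barrier_factor :: "nat \<Rightarrow> factor \<Rightarrow> bool" where
  "barrier_factor w f \<longleftrightarrow>
     (let L = set (factor_labels f); k = factor_dim f
      in barrier L w k (cel_class L w k (factor_chain f)))"

definition valid_generator :: "nat set \<Rightarrow> nat \<Rightarrow> factor list \<Rightarrow> bool" where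
  "valid_generator L w fs \<longleftrightarrow> (\<forall>f\<in>set fs. valid_factor w f) \<and>
     distinct (concat (map factor_labels fs)) \<and> set (concat (map factor_labels fs)) = L"

definition generator_chain :: "factor list \<Rightarrow> symbol \<Rightarrow>\<^sub>0 int" where
  "generator_chain fs = foldr chain_append (map factor_chain fs) (frag_of [])"

text \<open>The classes of the degree \<open>k\<close> generators with exactly \<open>j\<close> barrier factors.\<close>

definition barrier_generators ::
    "nat set \<Rightarrow> nat \<Rightarrow> nat \<Rightarrow> nat \<Rightarrow> (symbol \<Rightarrow>\<^sub>0 int) set set" where
  "barrier_generators L w k j = {cel_class L w k (generator_chain fs) | fs.
     valid_generator L w fs \<and> sum_list (map factor_dim fs) = k \<and>
     length (filter (barrier_factor w) fs) = j}"

text \<open>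
  \<open>generate G S\<close>, the subgroup generated by \<open>S\<close>, is the set of finite signed sums of
  elements of \<open>S\<close>.
\<close>

abbreviation signed_sums :: "('a, 'b) monoid_scheme \<Rightarrow> 'a set \<Rightarrow> 'a set" where
  "signed_sums \<equiv> generate"

end

theory Submission
  imports Defs
begin

text \<open>
  For distinct labels the filters \<open>F(W(a,b), c, d)\<close> and \<open>F(W(a,b), d, c)\<close> add up to the boundary of
  the juxtaposition \<open>W(a,b) W(c,d)\<close>, which is the sum \<open>P(a,b,c,d)\<close> of the two concatenation products
  of \<open>W(a,b)\<close> and \<open>W(c,d)\<close>.  In width 3 wheels of size 2 are not barriers and these filters are, so
  expanding none, one or both of the factors of \<open>z = P(1,2,3,4) | P(5,6,7,8)\<close> into filters gives the
  three representations.  The class is not zero because a cell of type 2|2|2|2 is not a face of any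
  cell with blocks of size at most 3, so its coefficient is a cocycle; the cells of type 1|3|1 show
  in the same way that the filters are barriers.
\<close>

section \<open>Bilinearity of concatenation\<close>

lemma chain_append_0_left [simp]: "chain_append 0 d = 0"
  by (simp add: chain_append_def)

lemma chain_append_0_right [simp]: "chain_append c 0 = 0"
  by (simp add: chain_append_def frag_extend_eq_0)

lemma chain_append_frag_of [simp]: "chain_append (frag_of s) (frag_of t) = frag_of (s @ t)"
  by (simp add: chain_append_def)

lemma chain_append_add_left: "chain_append (c + c') d = chain_append c d + chain_append c' d"
  by (simp add: chain_append_def frag_extend_add)

lemma chain_append_diff_left: "chain_append (c - c') d = chain_append c d - chain_append c' d"
  by (simp add: chain_append_def frag_extend_diff)

lemma chain_append_cmul_left: "chain_append (frag_cmul k c) d = frag_cmul k (chain_append c d)"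
  by (simp add: chain_append_def frag_extend_cmul)

lemma chain_append_minus_left: "chain_append (- c) d = - chain_append c d"
  by (simp add: chain_append_def frag_extend_minus)

text \<open>The left argument feeds the outer \<open>frag_extend\<close>, so linearity there is
  immediate. On the right it takes \<open>frag_induction\<close> on \<open>c\<close>, down to a
  single list, where one \<open>frag_extend\<close> remains.\<close>

lemma chain_append_minus_right: "chain_append c (- d) = - chain_append c d"
  using frag_induction[of c UNIV "\<lambda>c. chain_append c (- d) = - chain_append c d"]
  by (simp add: chain_append_diff_left) (simp add: chain_append_def frag_extend_minus)

lemma chain_append_add_right: "chain_append c (d + d') = chain_append c d + chain_append c d'"
  using frag_induction[of c UNIV "\<lambda>c. chain_append c (d + d') = chain_append c d + chain_append c d'"]
  by (simp add: chain_append_diff_left) (simp add: chain_append_def frag_extend_add)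

lemma chain_append_diff_right: "chain_append c (d - d') = chain_append c d - chain_append c d'"
  using chain_append_add_right[of c d "- d'"] by (simp add: chain_append_minus_right)

lemma frag_cmul_diff_distrib2: "frag_cmul k (a - b) = frag_cmul k a - frag_cmul k b"
  by (rule poly_mapping_eqI) (simp add: lookup_minus right_diff_distrib)

lemma chain_append_cmul_right: "chain_append c (frag_cmul k d) = frag_cmul k (chain_append c d)"
  using frag_induction[of c UNIV "\<lambda>c. chain_append c (frag_cmul k d) = frag_cmul k (chain_append c d)"]
  by (simp add: chain_append_diff_left frag_cmul_diff_distrib2)
    (simp add: chain_append_def frag_extend_cmul)

lemmas chain_append_simps =
  chain_append_add_left chain_append_add_right chain_append_diff_left chain_append_diff_right
  chain_append_minus_left chain_append_minus_right chain_append_cmul_left chain_append_cmul_right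

text \<open>By trilinearity this reduces to associativity of \<open>@\<close>; the arguments become
  single lists one at a time, starting with \<open>e\<close>.\<close>

lemma chain_append_assoc:
  "chain_append (chain_append c d) e = chain_append c (chain_append d e)"
proof -
  have "chain_append (chain_append (frag_of s) (frag_of t)) e =
      chain_append (frag_of s) (chain_append (frag_of t) e)" for s t :: "'a list"
    using frag_induction[of e UNIV "\<lambda>e. chain_append (frag_of (s @ t)) e =
      chain_append (frag_of s) (chain_append (frag_of t) e)"]
    by (simp add: chain_append_simps)
  then have "chain_append (chain_append (frag_of s) d) e = chain_append (frag_of s) (chain_append d e)"
    for s :: "'a list"
    using frag_induction[of d UNIV "\<lambda>d. chain_append (chain_append (frag_of s) d) e =
      chain_append (frag_of s) (chain_append d e)"]
    by (simp add: chain_append_simps)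
  then show ?thesis
    using frag_induction[of c UNIV "\<lambda>c. chain_append (chain_append c d) e =
      chain_append c (chain_append d e)"]
    by (simp add: chain_append_simps)
qed

lemma chain_append_frag_of_Nil [simp]:
  "chain_append c (frag_of []) = c" "chain_append (frag_of []) c = c"
  by (simp_all add: chain_append_def flip: frag_expansion)

lemma keys_chain_append:
  "Poly_Mapping.keys (chain_append c d) \<subseteq>
    {s @ t | s t. s \<in> Poly_Mapping.keys c \<and> t \<in> Poly_Mapping.keys d}"
proof -
  have "Poly_Mapping.keys (frag_extend (\<lambda>t. frag_of (s @ t)) d) \<subseteq> {s @ t | t. t \<in> Poly_Mapping.keys d}"
    for s using keys_frag_extend[of "\<lambda>t. frag_of (s @ t)" d] by auto
  then show ?thesis
    unfolding chain_append_def
    by (intro order_trans[OF keys_frag_extend]) (force simp: subset_iff)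
qed


section \<open>Signs of rearrangements\<close>

text \<open>A permutation of \<open>set g\<close> is determined by its values along
  \<open>g\<close>, so any witness evaluates the definite description.\<close>

lemma rearrangement_sign_eqI:
  assumes "p permutes set g" "map p g = h"
  shows "rearrangement_sign g h = sign p"
proof -
  have "q = p" if "q permutes set g" "map q g = h" for q
  proof
    fix x show "q x = p x"
      using that assms by (cases "x \<in> set g") (auto simp: permutes_not_in)
  qed
  then have "(THE p. p permutes set g \<and> map p g = h) = p"
    using assms by blast
  then show ?thesis by (simp add: rearrangement_sign_def)
qed

text \<open>Extend \<open>p\<close> by fixing \<open>x\<close>; carrying \<open>x\<close> from the
  front past the entries of \<open>u\<close> then costs one transposition each.\<close>

lemma ex_rearrangement_Cons:
  assumes "p permutes set g" "map p g = u @ v" "distinct (x # g)"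
  shows "\<exists>q. q permutes set (x # g) \<and> map q (x # g) = u @ x # v \<and> sign q = (-1) ^ length u * sign p"
  using assms(2)
proof (induction u arbitrary: v rule: rev_induct)
  case Nil
  have "p permutes set (x # g)"
    using assms(1) by (rule permutes_subset) auto
  moreover have "p x = x"
    using assms by (auto simp: permutes_not_in)
  ultimately show ?case using Nil by auto
next
  case (snoc y u)
  \<comment> \<open>The induction hypothesis, applied with \<open>y # v\<close> on the right, puts
    \<open>x\<close> just before \<open>y\<close>.\<close>
  then obtain q where q: "q permutes set (x # g)" "map q (x # g) = u @ x # y # v"
      "sign q = (-1) ^ length u * sign p"
    by auto
  have xy: "x \<in> set (x # g)" "y \<in> set (x # g)" "x \<noteq> y" "x \<notin> set (u @ v)" "y \<notin> set (u @ v)"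
  proof -
    have s: "set (map p g) = set g" using permutes_image[OF assms(1)] by simp
    have "distinct (map p g)"
      using assms(3) permutes_inj[OF assms(1)] by (auto simp: distinct_map intro: inj_on_subset)
    then show "x \<in> set (x # g)" "y \<in> set (x # g)" "x \<noteq> y" "x \<notin> set (u @ v)" "y \<notin> set (u @ v)"
      using s snoc.prems assms(3) by auto
  qed
  \<comment> \<open>Exchanging the neighbours \<open>x\<close> and \<open>y\<close> flips the sign
    and moves nothing else.\<close>
  let ?t = "Transposition.transpose x y"
  have fixed: "map ?t u = u" "map ?t v = v"
    using xy by (auto intro!: map_idI simp: Transposition.transpose_def)
  have "?t \<circ> q permutes set (x # g)"
    using q(1) xy by (intro permutes_compose permutes_swap_id)
  moreover have "map (?t \<circ> q) (x # g) = (u @ [y]) @ x # v"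
    unfolding map_map[symmetric] q(2) by (simp add: fixed)
  moreover have "sign (?t \<circ> q) = (-1) ^ length (u @ [y]) * sign p"
    using q xy(3) by (subst sign_compose)
      (auto simp: sign_swap_id permutation_swap_id intro: permutes_imp_permutation[of "set (x # g)"])
  ultimately show ?case by blast
qed

lemma ex_rearrangement:
  assumes "distinct g" "distinct h" "set g = set h"
  shows "\<exists>p. p permutes set g \<and> map p g = h"
  using assms
proof (induction g arbitrary: h)
  case Nil
  then show ?case by (auto intro: permutes_id)
next
  case (Cons x g)
  then obtain u v where h: "h = u @ x # v"
    using split_list[of x h] by auto
  have "set g = set (u @ v)" "distinct (u @ v)"
    using Cons.prems h by (auto simp: insert_eq_iff)
  with Cons.IH[of "u @ v"] Cons.prems(1) obtain p where "p permutes set g" "map p g = u @ v"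
    by auto
  from ex_rearrangement_Cons[OF this Cons.prems(1)] show ?case
    unfolding h by blast
qed

lemma rearrangement_sign_Nil [simp]: "rearrangement_sign [] [] = 1"
  using rearrangement_sign_eqI[of id "[]"] by (simp add: permutes_id)

text \<open>The entries of \<open>h\<close> before \<open>x\<close> are those that \<open>x\<close>
  has to pass. Iterating this evaluates signs of explicit lists; the hypotheses on length and
  inclusion force equal label sets and are easy to decide for such lists.\<close>

lemma rearrangement_sign_Cons:
  assumes "distinct (x # g)" "distinct h" "length h = length (x # g)" "set (x # g) \<subseteq> set h"
  shows "rearrangement_sign (x # g) h =
    (-1) ^ length (takeWhile (\<lambda>y. y \<noteq> x) h) * rearrangement_sign g (remove1 x h)"
proof -
  have "set (x # g) = set h"
    using assms by (intro card_subset_eq) (auto simp only: List.finite_set distinct_card)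
  moreover obtain u v where h: "h = u @ x # v" "x \<notin> set u"
    using split_list_first[of x h] assms(4) by auto
  ultimately have "set g = set (u @ v)" "distinct (u @ v)"
    using assms(1,2) by (auto simp: insert_eq_iff)
  then obtain p where p: "p permutes set g" "map p g = u @ v"
    using ex_rearrangement[of g "u @ v"] assms(1) by auto
  from ex_rearrangement_Cons[OF this assms(1)] obtain q
    where "q permutes set (x # g)" "map q (x # g) = u @ x # v" "sign q = (-1) ^ length u * sign p"
    by blast
  then have "rearrangement_sign (x # g) h = (-1) ^ length u * rearrangement_sign g (u @ v)"
    using p h by (simp add: rearrangement_sign_eqI)
  moreover have "takeWhile (\<lambda>y. y \<noteq> x) h = u" "remove1 x h = u @ v"
    using h by (auto simp: takeWhile_append remove1_append)
  ultimately show ?thesis by simp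
qed


section \<open>The boundary of a block\<close>

text \<open>Each letter goes to the left or to the right list. This enumerates the inverse of
  \<open>shuffles\<close> and turns the boundary of an explicit block into a finite
  computation.\<close>

fun unshuffles :: "'a list \<Rightarrow> ('a list \<times> 'a list) list" where
  "unshuffles [] = [([], [])]"
| "unshuffles (x # g) =
     map (apfst (Cons x)) (unshuffles g) @ map (apsnd (Cons x)) (unshuffles g)"

lemma set_unshuffles: "set (unshuffles g) = {(a, b). g \<in> shuffles a b}"
proof (induction g)
  case (Cons x g)
  have "(a, b) \<in> set (unshuffles (x # g)) \<longleftrightarrow> x # g \<in> shuffles a b" for a b
  proof -
    have "(a, b) \<in> set (unshuffles (x # g)) \<longleftrightarrow>
        (\<exists>a'. a = x # a' \<and> g \<in> shuffles a' b) \<or> (\<exists>b'. b = x # b' \<and> g \<in> shuffles a b')"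
      using Cons.IH by (fastforce simp: image_iff)
    also have "\<dots> \<longleftrightarrow> x # g \<in> shuffles a b"
      by (cases a; cases b) (auto simp: Cons_in_shuffles_iff)
    finally show ?thesis .
  qed
  then show ?case by auto
qed auto

text \<open>The two halves of the recursion cannot meet: \<open>x\<close> heads the left list in one
  of them, while in the other the left list has only letters of \<open>g\<close>. Hence a sum over
  the list counts every splitting once.\<close>

lemma distinct_unshuffles: "distinct g \<Longrightarrow> distinct (unshuffles g)"
proof (induction g)
  case (Cons x g)
  have "a = [] \<or> hd a \<noteq> x" if "(a, b) \<in> set (unshuffles g)" for a b
    using that Cons.prems set_shuffles[of g a b] by (cases a) (auto simp: set_unshuffles)
  then have "apfst (Cons x) ` set (unshuffles g) \<inter> apsnd (Cons x) ` set (unshuffles g) = {}"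
    by fastforce
  with Cons show ?case
    by (auto simp: distinct_map inj_on_def)
qed auto

lemma block_boundary_unshuffles:
  assumes "distinct g"
  shows "block_boundary g =
    (\<Sum>(a, b)\<leftarrow>filter (\<lambda>(a, b). a \<noteq> [] \<and> b \<noteq> []) (unshuffles g).
      frag_cmul ((-1) ^ length a * rearrangement_sign g (a @ b)) (frag_of [a, b]))"
proof -
  have "{(a, b). a \<noteq> [] \<and> b \<noteq> [] \<and> g \<in> shuffles a b} =
      set (filter (\<lambda>(a, b). a \<noteq> [] \<and> b \<noteq> []) (unshuffles g))"
    by (auto simp: set_unshuffles)
  then show ?thesis
    unfolding block_boundary_def
    by (simp only: sum.distinct_set_conv_list distinct_filter distinct_unshuffles[OF assms])
qed

section \<open>Boundaries of blocks with at most four labels\<close>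

lemma block_boundary_1: "block_boundary [a] = 0"
  by (simp add: block_boundary_unshuffles)

lemma block_boundary_2:
  "distinct [a, b] \<Longrightarrow> block_boundary [a, b] = frag_of [[b], [a]] - frag_of [[a], [b]]"
  by (simp add: block_boundary_unshuffles rearrangement_sign_Cons)

lemma block_boundary_3:
  "distinct [a, b, c] \<Longrightarrow> block_boundary [a, b, c] =
     frag_of [[a, b], [c]] - frag_of [[a, c], [b]] - frag_of [[a], [b, c]]
     + frag_of [[b, c], [a]] + frag_of [[b], [a, c]] - frag_of [[c], [a, b]]"
  by (simp add: block_boundary_unshuffles rearrangement_sign_Cons)

text \<open>Such a block is too long to be a cell in width 3, but its boundary is supported on cells
  there and yields the filters.\<close>

lemma block_boundary_4:
  "distinct [a, b, c, d] \<Longrightarrow> block_boundary [a, b, c, d] =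
     - frag_of [[a, b, c], [d]] + frag_of [[a, b, d], [c]] + frag_of [[a, b], [c, d]]
     - frag_of [[a, c, d], [b]] - frag_of [[a, c], [b, d]] + frag_of [[a, d], [b, c]]
     - frag_of [[a], [b, c, d]] + frag_of [[b, c, d], [a]] + frag_of [[b, c], [a, d]]
     - frag_of [[b, d], [a, c]] + frag_of [[b], [a, c, d]] + frag_of [[c, d], [a, b]]
     - frag_of [[c], [a, b, d]] + frag_of [[d], [a, b, c]]"
  by (simp add: block_boundary_unshuffles rearrangement_sign_Cons)


section \<open>The Leibniz rule\<close>

text \<open>The dimension of a cell, read off without its label set. Truncated subtraction agrees
  with the exponent in \<open>symbol_boundary\<close> even at an empty block.\<close>

definition symbol_dim :: "symbol \<Rightarrow> nat" where
  "symbol_dim s = (\<Sum>b\<leftarrow>s. length b - 1)"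

text \<open>Iterates the defining Leibniz rule, so that a symbol may be cut between any two blocks;
  the sign exponents of the blocks of \<open>s\<close> add up.\<close>

lemma symbol_boundary_append:
  "symbol_boundary (s @ t) = chain_append (symbol_boundary s) (frag_of t)
     + frag_cmul ((-1) ^ symbol_dim s) (chain_append (frag_of s) (symbol_boundary t))"
proof (induction s)
  case (Cons g s)
  have "chain_append (frag_of [g]) (chain_append (frag_of s) (symbol_boundary t)) =
      chain_append (frag_of (g # s)) (symbol_boundary t)"
    by (simp flip: chain_append_assoc)
  with Cons show ?case
    by (simp add: symbol_dim_def chain_append_simps chain_append_assoc frag_cmul_distrib2 power_add
        add.assoc)
qed (simp add: symbol_dim_def)

lemma boundary_frag_of [simp]: "boundary (frag_of s) = symbol_boundary s"
  by (simp add: boundary_def)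

lemma boundary_0 [simp]: "boundary 0 = 0"
  by (simp add: boundary_def)

lemma boundary_add: "boundary (c + d) = boundary c + boundary d"
  by (simp add: boundary_def frag_extend_add)

lemma boundary_diff: "boundary (c - d) = boundary c - boundary d"
  by (simp add: boundary_def frag_extend_diff)

lemma boundary_minus: "boundary (- c) = - boundary c"
  by (simp add: boundary_def frag_extend_minus)

text \<open>The sign depends on the dimension of each symbol of \<open>c\<close>. Homogeneity makes
  it constant, and then both sides are linear in \<open>c\<close> and in \<open>d\<close>.\<close>

lemma boundary_chain_append:
  assumes "Poly_Mapping.keys c \<subseteq> {s. symbol_dim s = k}"
  shows "boundary (chain_append c d) =
    chain_append (boundary c) d + frag_cmul ((-1) ^ k) (chain_append c (boundary d))"
proof -
  have *: "boundary (chain_append (frag_of s) d) = chain_append (symbol_boundary s) d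
      + frag_cmul ((-1) ^ symbol_dim s) (chain_append (frag_of s) (boundary d))" for s
    using subset_UNIV
    by (induction d rule: frag_induction)
      (simp_all add: symbol_boundary_append chain_append_simps boundary_diff frag_cmul_diff_distrib2)
  show ?thesis
    using assms
    by (induction c rule: frag_induction)
      (simp_all add: * chain_append_simps boundary_diff frag_cmul_diff_distrib2)
qed

text \<open>A nonempty block contributes one less than its number of labels, so the total is the
  number of labels minus the number of blocks.\<close>

lemma symbol_dim_cells:
  assumes "s \<in> cells L w k"
  shows "symbol_dim s = k"
proof -
  have "symbol_dim s + length s = length (concat s)" if "\<forall>b\<in>set s. b \<noteq> []" for s :: symbol
    using that
  proof (induction s)
    case (Cons b s)
    then show ?case by (cases b) (auto simp: symbol_dim_def)
  qed (simp add: symbol_dim_def)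
  moreover have "length (concat s) = card L"
    using assms distinct_card[of "concat s"] by (auto simp: cells_def)
  ultimately have "symbol_dim s + length s = card L"
    using assms by (simp add: cells_def)
  moreover have "k + length s = card L"
    using assms by (simp add: cells_def)
  ultimately show ?thesis by simp
qed

section \<open>Concatenation of cells and of cycles\<close>

lemma cells_append:
  assumes "s \<in> cells L w k" "t \<in> cells M w l" "L \<inter> M = {}"
  shows "s @ t \<in> cells (L \<union> M) w (k + l)"
proof -
  have "finite L" "finite M"
    using assms by (auto simp: cells_def)
  then show ?thesis
    using assms by (simp add: cells_def card_Un_disjoint Un_commute ball_Un)
qed

lemma cel_cycles_iff:
  "c \<in> cel_cycles L w k \<longleftrightarrow> Poly_Mapping.keys c \<subseteq> cells L w k \<and> boundary c = 0"
  by (auto simp: cel_cycles_def)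

text \<open>Both terms of the Leibniz rule vanish, and disjointness keeps the labels
  distinct.\<close>

lemma cel_cycles_chain_append:
  assumes "c \<in> cel_cycles L w k" "d \<in> cel_cycles M w l" "L \<inter> M = {}"
  shows "chain_append c d \<in> cel_cycles (L \<union> M) w (k + l)"
proof -
  have "Poly_Mapping.keys (chain_append c d) \<subseteq> cells (L \<union> M) w (k + l)"
    using assms(1,2) cells_append[OF _ _ assms(3)]
    by (intro order_trans[OF keys_chain_append]) (auto simp: cel_cycles_iff subset_iff)
  moreover have "Poly_Mapping.keys c \<subseteq> {s. symbol_dim s = k}"
    using assms(1) symbol_dim_cells by (auto simp: cel_cycles_iff)
  ultimately show ?thesis
    using assms by (simp add: cel_cycles_iff boundary_chain_append)
qed


section \<open>Homology classes\<close>

lemma cel_boundaries_iff: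
  "h \<in> cel_boundaries L w k \<longleftrightarrow> (\<exists>c. Poly_Mapping.keys c \<subseteq> cells L w (Suc k) \<and> h = boundary c)"
  unfolding cel_boundaries_def image_iff Bex_def carrier_free_Abelian_group_iff ..

lemma zero_in_cel_boundaries: "0 \<in> cel_boundaries L w k"
  unfolding cel_boundaries_iff by (rule exI[of _ 0]) simp

lemma cel_boundaries_add:
  assumes "h \<in> cel_boundaries L w k" "h' \<in> cel_boundaries L w k"
  shows "h + h' \<in> cel_boundaries L w k"
proof -
  obtain c c' where c: "Poly_Mapping.keys c \<subseteq> cells L w (Suc k)" "h = boundary c"
    "Poly_Mapping.keys c' \<subseteq> cells L w (Suc k)" "h' = boundary c'"
    using assms unfolding cel_boundaries_iff by blast
  have "Poly_Mapping.keys (c + c') \<subseteq> cells L w (Suc k)"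
    using keys_add[of c c'] c by blast
  then show ?thesis
    unfolding cel_boundaries_iff using c by (intro exI[of _ "c + c'"]) (simp add: boundary_add)
qed

lemma cel_boundaries_minus:
  assumes "h \<in> cel_boundaries L w k"
  shows "- h \<in> cel_boundaries L w k"
proof -
  obtain c where "Poly_Mapping.keys c \<subseteq> cells L w (Suc k)" "h = boundary c"
    using assms unfolding cel_boundaries_iff by blast
  then show ?thesis
    unfolding cel_boundaries_iff by (intro exI[of _ "- c"]) (simp add: boundary_minus keys_minus)
qed

lemma mult_cel_cycle_group [simp]: "x \<otimes>\<^bsub>cel_cycle_group L w k\<^esub> y = x + y"
  by (simp add: cel_cycle_group_def)

text \<open>Describing cosets elementwise turns equality and addition of classes into statements
  about \<open>cel_boundaries\<close>, for arbitrary chains \<open>c\<close>.\<close>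

lemma cel_class_iff: "c' \<in> cel_class L w k c \<longleftrightarrow> c' - c \<in> cel_boundaries L w k"
proof -
  have "c' = h + c \<longleftrightarrow> c' - c = h" for h
    by (auto simp: algebra_simps)
  then show ?thesis by (simp add: cel_class_def r_coset_def)
qed

lemma cel_class_eq_iff: "cel_class L w k c = cel_class L w k d \<longleftrightarrow> c - d \<in> cel_boundaries L w k"
proof
  assume "cel_class L w k c = cel_class L w k d"
  then show "c - d \<in> cel_boundaries L w k"
    using cel_class_iff[of c L w k c] cel_class_iff[of c L w k d] zero_in_cel_boundaries by simp
next
  assume cd: "c - d \<in> cel_boundaries L w k"
  have "x - c \<in> cel_boundaries L w k \<longleftrightarrow> x - d \<in> cel_boundaries L w k" for x
    using cel_boundaries_add[OF _ cd, of "x - c"]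
      cel_boundaries_add[OF _ cel_boundaries_minus[OF cd], of "x - d"] by (auto simp: diff_add_eq)
  then show "cel_class L w k c = cel_class L w k d"
    by (auto simp: cel_class_iff)
qed

lemma mult_cel_class:
  "cel_class L w k c \<otimes>\<^bsub>cel_homology L w k\<^esub> cel_class L w k d = cel_class L w k (c + d)"
proof -
  have "x - (c + d) \<in> cel_boundaries L w k \<longleftrightarrow>
      (\<exists>u v. u - c \<in> cel_boundaries L w k \<and> v - d \<in> cel_boundaries L w k \<and> x = u + v)" for x
  proof
    assume "x - (c + d) \<in> cel_boundaries L w k"
    then show "\<exists>u v. u - c \<in> cel_boundaries L w k \<and> v - d \<in> cel_boundaries L w k \<and> x = u + v"
      \<comment> \<open>\<open>d\<close> represents its own class and leaves \<open>x - d\<close>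
        for the other one.\<close>
      by (intro exI[of _ "x - d"] exI[of _ d]) (simp add: algebra_simps zero_in_cel_boundaries)
  next
    assume "\<exists>u v. u - c \<in> cel_boundaries L w k \<and> v - d \<in> cel_boundaries L w k \<and> x = u + v"
    then obtain u v where uv: "u - c \<in> cel_boundaries L w k" "v - d \<in> cel_boundaries L w k" "x = u + v"
      by blast
    then show "x - (c + d) \<in> cel_boundaries L w k"
      using cel_boundaries_add[OF uv(1,2)] by (simp add: add_diff_add)
  qed
  then show ?thesis
    unfolding set_eq_iff by (simp add: cel_homology_def FactGroup_def set_mult_def cel_class_iff Bex_def)
qed

lemma one_cel_homology: "\<one>\<^bsub>cel_homology L w k\<^esub> = cel_class L w k 0"
  by (auto simp: cel_homology_def FactGroup_def cel_class_iff)

lemma cel_class_closed: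
  assumes "c \<in> cel_cycles L w k"
  shows "cel_class L w k c \<in> carrier (cel_homology L w k)"
proof -
  have "c \<in> carrier (cel_cycle_group L w k)"
    using assms by (simp add: cel_cycle_group_def carrier_subgroup_generated cel_cycles_def generate.incl)
  then show ?thesis
    by (auto simp: cel_homology_def FactGroup_def RCOSETS_def cel_class_def)
qed

lemma cel_cycles_add:
  "\<lbrakk>c \<in> cel_cycles L w k; d \<in> cel_cycles L w k\<rbrakk> \<Longrightarrow> c + d \<in> cel_cycles L w k"
  using keys_add[of c d] by (auto simp: cel_cycles_iff boundary_add)


section \<open>A cocycle criterion\<close>

lemma keys_block_boundary:
  "Poly_Mapping.keys (block_boundary g) \<subseteq> {[a, b] | a b. length a + length b = length g}"
proof -
  have "Poly_Mapping.keys (block_boundary g) \<subseteq>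
      (\<Union>ab\<in>{(a, b). a \<noteq> [] \<and> b \<noteq> [] \<and> g \<in> shuffles a b}. Poly_Mapping.keys (case ab of (a, b) \<Rightarrow>
        frag_cmul ((-1) ^ length a * rearrangement_sign g (a @ b)) (frag_of [a, b])))"
    unfolding block_boundary_def by (rule keys_sum)
  also have "\<dots> \<subseteq> {[a, b] | a b. length a + length b = length g}"
    by (auto simp: length_shuffles)
  finally show ?thesis .
qed

text \<open>Each boundary term replaces one block by two neighbours whose lengths add up to its
  length, which is at most \<open>w\<close>; this pair violates the inequality. It is either at the
  front or in the tail, where induction finds it.\<close>

lemma symbol_boundary_merges_blocks:
  assumes "\<forall>b\<in>set s. length b \<le> w" "t \<in> Poly_Mapping.keys (symbol_boundary s)"
  shows "\<not> successively (\<lambda>a b. w < length a + length b) t"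
  using assms
proof (induction s arbitrary: t)
  case (Cons g s)
  let ?c = "chain_append (block_boundary g) (frag_of s)"
  let ?d = "chain_append (frag_of [g]) (symbol_boundary s)"
  have "Poly_Mapping.keys ?c \<subseteq> {[a, b] @ s | a b. length a + length b = length g}"
    using keys_block_boundary[of g]
    by (intro order_trans[OF keys_chain_append]) (auto simp: subset_iff)
  moreover have "Poly_Mapping.keys ?d \<subseteq> {g # t' | t'. t' \<in> Poly_Mapping.keys (symbol_boundary s)}"
    by (intro order_trans[OF keys_chain_append]) auto
  moreover have "t \<in> Poly_Mapping.keys ?c \<union> Poly_Mapping.keys ?d"
    using Cons.prems(2) keys_add[of ?c "frag_cmul ((-1) ^ (length g - 1)) ?d"] by auto
  ultimately consider a b where "t = a # b # s" "length a + length b = length g"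
    | t' where "t = g # t'" "t' \<in> Poly_Mapping.keys (symbol_boundary s)"
    by auto
  then show ?case
  proof cases
    case 1
    then show ?thesis using Cons.prems(1) by auto
  next
    case 2
    then show ?thesis using Cons.IH[of t'] Cons.prems(1) by (auto simp: successively_Cons)
  qed
qed auto

text \<open>The boundary splits blocks of length at most \<open>w\<close>; so a cell in which no two neighbouring
  blocks fit together into one block has coefficient \<open>0\<close> in every boundary.\<close>

lemma lookup_cel_boundaries_eq_0:
  assumes "h \<in> cel_boundaries L w k" "successively (\<lambda>a b. w < length a + length b) t"
  shows "Poly_Mapping.lookup h t = 0"
proof (rule ccontr)
  assume "Poly_Mapping.lookup h t \<noteq> 0"
  then have t: "t \<in> Poly_Mapping.keys h" by (simp add: in_keys_iff)
  obtain c where c: "Poly_Mapping.keys c \<subseteq> cells L w (Suc k)" "h = boundary c"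
    using assms(1) by (auto simp: cel_boundaries_iff)
  obtain s where "s \<in> Poly_Mapping.keys c" "t \<in> Poly_Mapping.keys (symbol_boundary s)"
    using t keys_frag_extend[of symbol_boundary c] by (auto simp: c boundary_def)
  then show False
    using symbol_boundary_merges_blocks[of s w t] assms(2) c(1) by (auto simp: cells_def)
qed

text \<open>The coefficient at such a cell is a cocycle and thus an invariant of the homology class.
  All inequalities between classes below come from it.\<close>

lemma lookup_eq_if_cel_class_eq:
  assumes "cel_class L w k c = cel_class L w k d"
    "successively (\<lambda>a b. w < length a + length b) t"
  shows "Poly_Mapping.lookup c t = Poly_Mapping.lookup d t"
  using lookup_cel_boundaries_eq_0[of "c - d"] assms by (simp add: cel_class_eq_iff lookup_minus)


section \<open>Generators from wheels of size two and filters on four labels\<close>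

lemma generator_chain_in_cel_cycles:
  assumes "\<forall>f\<in>set fs. factor_chain f \<in> cel_cycles (set (factor_labels f)) w (factor_dim f)"
    and "distinct (concat (map factor_labels fs))"
  shows "generator_chain fs \<in>
    cel_cycles (set (concat (map factor_labels fs))) w (sum_list (map factor_dim fs))"
  using assms
proof (induction fs)
  case Nil
  \<comment> \<open>The empty product is the empty symbol, a 0-cell on no labels.\<close>
  then show ?case by (simp add: generator_chain_def cel_cycles_iff cells_def)
next
  case (Cons f fs)
  then have "chain_append (factor_chain f) (generator_chain fs) \<in>
      cel_cycles (set (factor_labels f) \<union> set (concat (map factor_labels fs))) w
        (factor_dim f + sum_list (map factor_dim fs))"
    by (intro cel_cycles_chain_append) auto
  then show ?case by (simp add: generator_chain_def)
qed

declare factor_chain.simps [simp del]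

section \<open>Wheels on at most two labels\<close>

lemma wheel_1: "wheel [a] = frag_of [a]"
  by (simp add: wheel.simps)

lemma wheel_2: "wheel [a, b] = frag_of [a, b] + frag_of [b, a]"
  by (simp add: wheel.simps)

lemma factor_chain_wheel_2:
  "factor_chain (Wheel [a, b]) = frag_of [[a, b]] + frag_of [[b, a]]"
  by (simp add: factor_chain.simps wheel_2 one_block_def frag_extend_add)

text \<open>The boundary of the block \<open>[a, b]\<close> is antisymmetric in its labels, so the
  two terms cancel.\<close>

lemma wheel_2_in_cel_cycles:
  assumes "distinct [a, b]" "2 \<le> w"
  shows "factor_chain (Wheel [a, b]) \<in> cel_cycles {a, b} w 1"
proof -
  have "frag_of [[a, b]] \<in> carrier (free_Abelian_group (cells {a, b} w 1))"
    "frag_of [[b, a]] \<in> carrier (free_Abelian_group (cells {a, b} w 1))"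
    using assms by (auto simp: cells_def)
  then have "Poly_Mapping.keys (factor_chain (Wheel [a, b])) \<subseteq> cells {a, b} w 1"
    unfolding factor_chain_wheel_2 using keys_add by fastforce
  moreover have "boundary (factor_chain (Wheel [a, b])) = 0"
    using assms by (simp add: factor_chain_wheel_2 boundary_add block_boundary_2)
  ultimately show ?thesis by (simp add: cel_cycles_iff)
qed

text \<open>The new disk and the wheel fit together into blocks of size three, and these give a
  chain whose boundary is the difference of the two concatenations.\<close>

lemma not_barrier_wheel_2:
  assumes "distinct [a, b]" "3 \<le> w"
  shows "\<not> barrier_factor w (Wheel [a, b])"
proof -
  let ?W = "factor_chain (Wheel [a, b])"
  \<comment> \<open>A 2-cell on two labels would have no blocks. So there are no boundaries in
    degree 1, and the wheel is the only representative of its class.\<close>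
  have "cells {a, b} w 2 = {}"
    using assms by (auto simp: cells_def)
  then have "cel_boundaries {a, b} w 1 = {0}"
    by (auto simp: cel_boundaries_iff numeral_2_eq_2)
  then have only: "c = ?W" if "c \<in> cel_class {a, b} w 1 ?W" for c
    using that by (simp add: cel_class_iff)
  have "cel_class (insert x {a, b}) w 1 (chain_append (frag_of [[x]]) ?W) =
      cel_class (insert x {a, b}) w 1 (chain_append ?W (frag_of [[x]]))" if x: "x \<notin> {a, b}" for x
  proof -
    \<comment> \<open>Up to sign, the juxtaposition of \<open>[x]\<close> with the wheel.\<close>
    let ?c = "- (frag_of [[x, a, b]] + frag_of [[x, b, a]])"
    have "Poly_Mapping.keys ?c \<subseteq> cells {x, a, b} w 2"
    proof -
      have "[[x, a, b]] \<in> cells {x, a, b} w 2" "[[x, b, a]] \<in> cells {x, a, b} w 2"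
        using assms x by (auto simp: cells_def)
      then show ?thesis
        using keys_add[of "frag_of [[x, a, b]]" "frag_of [[x, b, a]]"]
        unfolding keys_minus by auto
    qed
    moreover have "chain_append (frag_of [[x]]) ?W - chain_append ?W (frag_of [[x]]) = boundary ?c"
      using assms x
      by (simp add: factor_chain_wheel_2 chain_append_simps boundary_minus boundary_diff boundary_add
        block_boundary_3)
    ultimately show ?thesis
      unfolding cel_class_eq_iff cel_boundaries_iff numeral_2_eq_2 by auto
  qed
  then show ?thesis
    using only by (auto simp: barrier_factor_def barrier_def Let_def)
qed

text \<open>The juxtaposed wheels are \<open>[a, b, c, d]\<close> plus \<open>[b, a, c, d]\<close>.
  Splittings that separate \<open>a\<close> from \<open>b\<close> occur in both boundaries with
  opposite signs, which leaves 12 of the 28 terms.\<close>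

lemma factor_chain_filter:
  assumes "distinct [a, b, c, d]"
  shows "factor_chain (Filter [[a, b], [c], [d]]) =
      frag_of [[a, b], [c, d]] + frag_of [[b, a], [c, d]]
    + frag_of [[c, d], [a, b]] + frag_of [[c, d], [b, a]]
    - frag_of [[a, b, c], [d]] - frag_of [[b, a, c], [d]]
    + frag_of [[a, b, d], [c]] + frag_of [[b, a, d], [c]]
    - frag_of [[c], [a, b, d]] - frag_of [[c], [b, a, d]]
    + frag_of [[d], [a, b, c]] + frag_of [[d], [b, a, c]]"
proof -
  have "factor_chain (Filter [[a, b], [c], [d]]) =
      block_boundary [a, b, c, d] + block_boundary [b, a, c, d]"
    by (simp add: factor_chain.simps wheel_1 wheel_2 one_block_def chain_append_simps frag_extend_add boundary_add)
  then show ?thesis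
    using assms by (simp add: block_boundary_4)
qed

text \<open>An instance of the boundary squaring to zero, checked directly on the twelve
  terms.\<close>

lemma filter_in_cel_cycles:
  assumes "distinct [a, b, c, d]" "3 \<le> w"
  shows "factor_chain (Filter [[a, b], [c], [d]]) \<in> cel_cycles {a, b, c, d} w 2"
proof -
  have "Poly_Mapping.keys (factor_chain (Filter [[a, b], [c], [d]])) \<subseteq>
      {[[a, b], [c, d]], [[b, a], [c, d]], [[c, d], [a, b]], [[c, d], [b, a]],
       [[a, b, c], [d]], [[b, a, c], [d]], [[a, b, d], [c]], [[b, a, d], [c]],
       [[c], [a, b, d]], [[c], [b, a, d]], [[d], [a, b, c]], [[d], [b, a, c]]}"
    unfolding factor_chain_filter[OF assms(1)]
    by (intro order_trans[OF keys_add] order_trans[OF keys_diff] Un_least) simp_all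
  also have "\<dots> \<subseteq> cells {a, b, c, d} w 2"
    using assms by (auto simp: cells_def)
  finally have "Poly_Mapping.keys (factor_chain (Filter [[a, b], [c], [d]])) \<subseteq> cells {a, b, c, d} w 2" .
  moreover have "boundary (factor_chain (Filter [[a, b], [c], [d]])) = 0"
    unfolding factor_chain_filter[OF assms(1)] using assms(1)
    by (simp add: boundary_add boundary_diff block_boundary_1 block_boundary_2 block_boundary_3
        chain_append_simps)
  ultimately show ?thesis by (simp add: cel_cycles_iff)
qed

text \<open>In the cell \<open>[[x], [a, b, c], [d]]\<close> neighbouring blocks have four labels
  together, so its coefficient is an invariant. It is \<open>-1\<close> with \<open>x\<close> on the
  left, and \<open>0\<close> with \<open>x\<close> on the right, where every symbol ends in
  \<open>[x]\<close>.\<close>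

lemma barrier_filter:
  assumes "distinct [a, b, c, d]"
  shows "barrier_factor 3 (Filter [[a, b], [c], [d]])"
proof -
  let ?F = "factor_chain (Filter [[a, b], [c], [d]])"
  obtain x where x: "x \<notin> {a, b, c, d}"
    using ex_new_if_finite[of "{a, b, c, d}"] by auto
  let ?t = "[[x], [a, b, c], [d]]"
  have "Poly_Mapping.lookup (chain_append (frag_of [[x]]) ?F) ?t = -1"
    unfolding factor_chain_filter[OF assms] using assms x
    by (simp add: chain_append_simps lookup_add lookup_minus)
  moreover have "Poly_Mapping.lookup (chain_append ?F (frag_of [[x]])) ?t = 0"
    unfolding factor_chain_filter[OF assms] using assms x
    by (simp add: chain_append_simps lookup_add lookup_minus)
  ultimately have "cel_class (insert x {a, b, c, d}) 3 2 (chain_append (frag_of [[x]]) ?F) \<noteq>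
      cel_class (insert x {a, b, c, d}) 3 2 (chain_append ?F (frag_of [[x]]))"
    using lookup_eq_if_cel_class_eq[of "insert x {a, b, c, d}" 3 2
      "chain_append (frag_of [[x]]) ?F" "chain_append ?F (frag_of [[x]])" ?t] by auto
  moreover have "?F \<in> cel_class {a, b, c, d} 3 2 ?F"
    by (simp add: cel_class_iff zero_in_cel_boundaries)
  ultimately have "barrier {a, b, c, d} 3 2 (cel_class {a, b, c, d} 3 2 ?F)"
    using cel_class_closed[OF filter_in_cel_cycles[OF assms]] x unfolding barrier_def by blast
  then show ?thesis
    by (simp add: barrier_factor_def Let_def numeral_2_eq_2)
qed

text \<open>Exchanging \<open>c\<close> and \<open>d\<close> negates the eight terms with a block of
  size three. The terms of type 2|2 keep their signs and supply both orders of \<open>c\<close> and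
  \<open>d\<close>.\<close>

lemma filter_add_filter:
  assumes "distinct [a, b, c, d]"
  shows "factor_chain (Filter [[a, b], [c], [d]]) + factor_chain (Filter [[a, b], [d], [c]]) =
    chain_append (factor_chain (Wheel [a, b])) (factor_chain (Wheel [c, d])) +
    chain_append (factor_chain (Wheel [c, d])) (factor_chain (Wheel [a, b]))"
  using assms by (simp add: factor_chain_filter factor_chain_wheel_2 chain_append_simps)

section \<open>Sums of four classes and their homomorphic images\<close>

lemma four_fold_product_in_generate:
  assumes "x \<in> S" "y \<in> S" "u \<in> S" "v \<in> S"
  shows "(x \<otimes>\<^bsub>G\<^esub> y) \<otimes>\<^bsub>G\<^esub> (u \<otimes>\<^bsub>G\<^esub> v) \<in> generate G S"
  using assms by (intro generate.eng generate.incl)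

text \<open>Each of the three expansions of the final class is a sum of four generators, so one
  statement serves them all, both in cellular homology and after transport by a
  homomorphism.\<close>

lemma sum_of_four_classes_in_generate:
  assumes S: "\<And>c. c \<in> {c1, c2, c3, c4} \<Longrightarrow> c \<in> cel_cycles L w k \<and> cel_class L w k c \<in> S"
    and c: "c = (c1 + c2) + (c3 + c4)"
  shows "cel_class L w k c \<in> carrier (cel_homology L w k)" (is ?A)
    and "cel_class L w k c \<in> generate (cel_homology L w k) S" (is ?B)
    and "\<And>\<Phi> H. \<Phi> \<in> hom (cel_homology L w k) H \<Longrightarrow> \<Phi> (cel_class L w k c) \<in> generate H (\<Phi> ` S)"
proof -
  let ?G = "cel_homology L w k" and ?cl = "cel_class L w k"
  have cl: "?cl c = (?cl c1 \<otimes>\<^bsub>?G\<^esub> ?cl c2) \<otimes>\<^bsub>?G\<^esub> (?cl c3 \<otimes>\<^bsub>?G\<^esub> ?cl c4)"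
    by (simp add: c mult_cel_class)
  show ?A
    unfolding c using S by (intro cel_class_closed cel_cycles_add) auto
  show ?B
    unfolding cl using S by (intro four_fold_product_in_generate) auto
  \<comment> \<open>\<open>hom_mult\<close> applies only inside the carrier, so the partial sums
    have to lie there too.\<close>
  have car: "?cl c1 \<in> carrier ?G" "?cl c2 \<in> carrier ?G" "?cl c3 \<in> carrier ?G" "?cl c4 \<in> carrier ?G"
    "?cl c1 \<otimes>\<^bsub>?G\<^esub> ?cl c2 \<in> carrier ?G" "?cl c3 \<otimes>\<^bsub>?G\<^esub> ?cl c4 \<in> carrier ?G"
    unfolding mult_cel_class using S by (auto intro!: cel_class_closed cel_cycles_add)
  fix \<Phi> H assume "\<Phi> \<in> hom ?G H"
  then have "\<Phi> (?cl c) = (\<Phi> (?cl c1) \<otimes>\<^bsub>H\<^esub> \<Phi> (?cl c2)) \<otimes>\<^bsub>H\<^esub> (\<Phi> (?cl c3) \<otimes>\<^bsub>H\<^esub> \<Phi> (?cl c4))"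
    unfolding cl using car by (simp add: hom_mult)
  then show "\<Phi> (?cl c) \<in> generate H (\<Phi> ` S)"
    using S by (auto intro!: four_fold_product_in_generate)
qed

theorem proposition8p6:
  shows "(\<exists>z \<in> carrier (cel_homology {1..8} 3 4).
            z \<noteq> \<one>\<^bsub>cel_homology {1..8} 3 4\<^esub> \<and>
            z \<in> signed_sums (cel_homology {1..8} 3 4) (barrier_generators {1..8} 3 4 0) \<and>
            z \<in> signed_sums (cel_homology {1..8} 3 4) (barrier_generators {1..8} 3 4 1) \<and>
            z \<in> signed_sums (cel_homology {1..8} 3 4) (barrier_generators {1..8} 3 4 2)) \<and>
         (\<forall>\<Phi> \<in> iso (cel_homology {1..8} 3 4) (homology_group 4 (config 8 3)).
          \<exists>z \<in> carrier (homology_group 4 (config 8 3)).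
            z \<noteq> \<one>\<^bsub>homology_group 4 (config 8 3)\<^esub> \<and>
            z \<in> signed_sums (homology_group 4 (config 8 3)) (\<Phi> ` barrier_generators {1..8} 3 4 0) \<and>
            z \<in> signed_sums (homology_group 4 (config 8 3)) (\<Phi> ` barrier_generators {1..8} 3 4 1) \<and>
            z \<in> signed_sums (homology_group 4 (config 8 3)) (\<Phi> ` barrier_generators {1..8} 3 4 2))"
proof -
  let ?G = "cel_homology {1..8} 3 4" and ?cl = "cel_class {1..8} 3 4"
  let ?W = "\<lambda>a b :: nat. Wheel [a, b]" and ?F = "\<lambda>a b c d :: nat. Filter [[a, b], [c], [d]]"
  have generator: "generator_chain fs \<in> cel_cycles {1..8} 3 4 \<and>
      ?cl (generator_chain fs) \<in> barrier_generators {1..8} 3 4 (length (filter (barrier_factor 3) fs))"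
    if fs: "\<forall>f\<in>set fs. valid_factor 3 f \<and>
          factor_chain f \<in> cel_cycles (set (factor_labels f)) 3 (factor_dim f)"
      "distinct (concat (map factor_labels fs))" "set (concat (map factor_labels fs)) \<subseteq> {1..8}"
      "length (concat (map factor_labels fs)) = 8"
      "sum_list (map factor_dim fs) = 4" for fs
  proof -
    \<comment> \<open>Eight distinct labels inside \<open>{1..8}\<close> exhaust it.\<close>
    have "card (set (concat (map factor_labels fs))) = 8"
      using distinct_card[OF fs(2)] fs(4) by simp
    then have "set (concat (map factor_labels fs)) = {1..8}"
      using fs(3) by (intro card_subset_eq) auto
    then show ?thesis
      using generator_chain_in_cel_cycles[of fs 3] fs
      by (auto simp: barrier_generators_def valid_generator_def)
  qed
  have wheel: "valid_factor 3 (?W a b) \<and> \<not> barrier_factor 3 (?W a b) \<and>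
      factor_chain (?W a b) \<in> cel_cycles {a, b} 3 (Suc 0)"
    if "distinct [a, b]" for a b
    using that wheel_2_in_cel_cycles[of a b 3] not_barrier_wheel_2[of a b 3] by simp
  have filter: "valid_factor 3 (?F a b c d) \<and> barrier_factor 3 (?F a b c d) \<and>
      factor_chain (?F a b c d) \<in> cel_cycles {a, b, c, d} 3 (Suc (Suc 0))"
    if "distinct [a, b, c, d]" for a b c d
    using that filter_in_cel_cycles[of a b c d 3] barrier_filter[of a b c d]
    by (simp add: numeral_2_eq_2)
  let ?w = "\<lambda>a b. factor_chain (?W a b)" and ?f = "\<lambda>a b c d. factor_chain (?F a b c d)"
  define c where "c = chain_append
      (chain_append (?w 1 2) (?w 3 4) + chain_append (?w 3 4) (?w 1 2))
      (chain_append (?w 5 6) (?w 7 8) + chain_append (?w 7 8) (?w 5 6))"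
  define z where "z = ?cl c"
  have filters1: "chain_append (?w 1 2) (?w 3 4) + chain_append (?w 3 4) (?w 1 2) = ?f 1 2 3 4 + ?f 1 2 4 3"
    and filters2: "chain_append (?w 5 6) (?w 7 8) + chain_append (?w 7 8) (?w 5 6) = ?f 5 6 7 8 + ?f 5 6 8 7"
    by (subst filter_add_filter; simp)+
  have c0: "c =
      (generator_chain [?W 1 2, ?W 3 4, ?W 5 6, ?W 7 8] + generator_chain [?W 1 2, ?W 3 4, ?W 7 8, ?W 5 6]) +
      (generator_chain [?W 3 4, ?W 1 2, ?W 5 6, ?W 7 8] + generator_chain [?W 3 4, ?W 1 2, ?W 7 8, ?W 5 6])"
    by (simp add: c_def generator_chain_def chain_append_simps chain_append_assoc algebra_simps)
  \<comment> \<open>Only the factor on the labels 1 to 4 is rewritten, so every summand has one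
    filter and two wheels.\<close>
  have c1: "c =
      (generator_chain [?F 1 2 3 4, ?W 5 6, ?W 7 8] + generator_chain [?F 1 2 3 4, ?W 7 8, ?W 5 6]) +
      (generator_chain [?F 1 2 4 3, ?W 5 6, ?W 7 8] + generator_chain [?F 1 2 4 3, ?W 7 8, ?W 5 6])"
    unfolding c_def filters1
    by (simp add: generator_chain_def chain_append_simps chain_append_assoc algebra_simps)
  have c2: "c =
      (generator_chain [?F 1 2 3 4, ?F 5 6 7 8] + generator_chain [?F 1 2 3 4, ?F 5 6 8 7]) +
      (generator_chain [?F 1 2 4 3, ?F 5 6 7 8] + generator_chain [?F 1 2 4 3, ?F 5 6 8 7])"
    unfolding c_def filters1 filters2
    by (simp add: generator_chain_def chain_append_simps algebra_simps)
  have no_barrier: "generator_chain fs \<in> cel_cycles {1..8} 3 4 \<and>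
      ?cl (generator_chain fs) \<in> barrier_generators {1..8} 3 4 0"
    if "fs \<in> {[?W 1 2, ?W 3 4, ?W 5 6, ?W 7 8], [?W 1 2, ?W 3 4, ?W 7 8, ?W 5 6],
      [?W 3 4, ?W 1 2, ?W 5 6, ?W 7 8], [?W 3 4, ?W 1 2, ?W 7 8, ?W 5 6]}" for fs
    using that generator[of fs] wheel by auto
  have one_barrier: "generator_chain fs \<in> cel_cycles {1..8} 3 4 \<and>
      ?cl (generator_chain fs) \<in> barrier_generators {1..8} 3 4 1"
    if "fs \<in> {[?F 1 2 3 4, ?W 5 6, ?W 7 8], [?F 1 2 3 4, ?W 7 8, ?W 5 6],
      [?F 1 2 4 3, ?W 5 6, ?W 7 8], [?F 1 2 4 3, ?W 7 8, ?W 5 6]}" for fs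
    using that generator[of fs] wheel filter by auto
  have two_barriers: "generator_chain fs \<in> cel_cycles {1..8} 3 4 \<and>
      ?cl (generator_chain fs) \<in> barrier_generators {1..8} 3 4 2"
    if "fs \<in> {[?F 1 2 3 4, ?F 5 6 7 8], [?F 1 2 3 4, ?F 5 6 8 7],
      [?F 1 2 4 3, ?F 5 6 7 8], [?F 1 2 4 3, ?F 5 6 8 7]}" for fs
    using that generator[of fs] filter by (auto simp: numeral_2_eq_2)
  note gen = sum_of_four_classes_in_generate[OF _ c0, of "{1..8}" 3 4 "barrier_generators {1..8} 3 4 0",
      folded z_def]
    sum_of_four_classes_in_generate[OF _ c1, of "{1..8}" 3 4 "barrier_generators {1..8} 3 4 1",
      folded z_def]
    sum_of_four_classes_in_generate[OF _ c2, of "{1..8}" 3 4 "barrier_generators {1..8} 3 4 2",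
      folded z_def]
  have z_gen: "z \<in> carrier ?G" "z \<in> generate ?G (barrier_generators {1..8} 3 4 0)"
    "z \<in> generate ?G (barrier_generators {1..8} 3 4 1)"
    "z \<in> generate ?G (barrier_generators {1..8} 3 4 2)"
    using no_barrier one_barrier two_barriers by (intro gen; blast)+
  have z_hom: "\<Phi> z \<in> generate H (\<Phi> ` barrier_generators {1..8} 3 4 0)"
    "\<Phi> z \<in> generate H (\<Phi> ` barrier_generators {1..8} 3 4 1)"
    "\<Phi> z \<in> generate H (\<Phi> ` barrier_generators {1..8} 3 4 2)"
    if "\<Phi> \<in> hom ?G H" for \<Phi> and H :: "(((nat \<Rightarrow> real) \<Rightarrow> nat \<Rightarrow> real \<times> real) \<Rightarrow>\<^sub>0 int) set monoid"
    using that no_barrier one_barrier two_barriers by (intro gen; blast)+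
  \<comment> \<open>Neighbouring blocks have four labels together, more than the width. Only the
    product of the four wheels in increasing order of labels contains this cell.\<close>
  let ?t = "[[1, 2], [3, 4], [5, 6], [7, 8]] :: symbol"
  have "Poly_Mapping.lookup c ?t = 1"
    by (simp add: c_def factor_chain_wheel_2 chain_append_simps lookup_add)
  then have "z \<noteq> ?cl 0"
    using lookup_eq_if_cel_class_eq[of "{1..8}" 3 4 c 0 ?t] by (auto simp: z_def)
  then have z_nontrivial: "z \<noteq> \<one>\<^bsub>?G\<^esub>"
    by (simp add: one_cel_homology)
  have one_carrier: "\<one>\<^bsub>?G\<^esub> \<in> carrier ?G"
    unfolding one_cel_homology by (intro cel_class_closed) (simp add: cel_cycles_iff)
  have "\<one>\<^bsub>?G\<^esub> \<otimes>\<^bsub>?G\<^esub> \<one>\<^bsub>?G\<^esub> = \<one>\<^bsub>?G\<^esub>"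
    by (simp add: one_cel_homology mult_cel_class)
  show ?thesis
  proof (intro conjI ballI)
    show "\<exists>z\<in>carrier ?G. z \<noteq> \<one>\<^bsub>?G\<^esub> \<and> z \<in> generate ?G (barrier_generators {1..8} 3 4 0) \<and>
        z \<in> generate ?G (barrier_generators {1..8} 3 4 1) \<and>
        z \<in> generate ?G (barrier_generators {1..8} 3 4 2)"
      using z_gen z_nontrivial by blast
  next
    let ?H = "homology_group 4 (config 8 3)"
    fix \<Phi> assume \<Phi>: "\<Phi> \<in> iso ?G ?H"
    then have hom: "\<Phi> \<in> hom ?G ?H" and inj: "inj_on \<Phi> (carrier ?G)"
      by (auto simp: iso_def bij_betw_def)
    \<comment> \<open>\<open>hom\<close> does not include preservation of the unit. The image of the
      unit is idempotent, and the only idempotent of the group \<open>?H\<close> is its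
      unit.\<close>
    have "\<Phi> \<one>\<^bsub>?G\<^esub> \<otimes>\<^bsub>?H\<^esub> \<Phi> \<one>\<^bsub>?G\<^esub> = \<Phi> \<one>\<^bsub>?G\<^esub>"
      using hom_mult[OF hom one_carrier one_carrier] \<open>\<one>\<^bsub>?G\<^esub> \<otimes>\<^bsub>?G\<^esub> \<one>\<^bsub>?G\<^esub> = \<one>\<^bsub>?G\<^esub>\<close> by simp
    then have "\<Phi> \<one>\<^bsub>?G\<^esub> = \<one>\<^bsub>?H\<^esub>"
      using hom_in_carrier[OF hom one_carrier] comm_group.axioms(2)[OF abelian_homology_group]
      by (simp add: group.l_cancel_one)
    then have "\<Phi> z \<noteq> \<one>\<^bsub>?H\<^esub>"
      using inj_onD[OF inj _ z_gen(1) one_carrier] z_nontrivial by auto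
    moreover have "\<Phi> z \<in> carrier ?H"
      using hom_in_carrier[OF hom z_gen(1)] .
    ultimately show "\<exists>z\<in>carrier ?H. z \<noteq> \<one>\<^bsub>?H\<^esub> \<and>
        z \<in> generate ?H (\<Phi> ` barrier_generators {1..8} 3 4 0) \<and>
        z \<in> generate ?H (\<Phi> ` barrier_generators {1..8} 3 4 1) \<and>
        z \<in> generate ?H (\<Phi> ` barrier_generators {1..8} 3 4 2)"
      using z_hom[OF hom] by blast
  qed
qed

end
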